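(* Let $d,n\ge1$ be integers, let $\sigma>0$, and let $\mathcal{P}$ be any class of probability measures on $\mathbb{R}^d$ with finite second moments (not necessarily closed under domination). Let $y_1,\dots,y_n\in\mathbb{R}^d$ be the observed values of $Y_1,\dots,Y_n$ in the Gaussian deconvolution model with noise variance $\sigma^2$. Then the maximum-likelihood estimator over $\mathcal{P}$, $$\hat P=\operatorname*{argmax}_{P\in\mathcal{P}}\ \sum_{i=1}^n\log\big(\varphi_\sigma\star \mathrm{d}P\big)(y_i),$$ satisfies $$\hat P=\operatorname*{argmin}_{P\in\mathcal{P}}\ W^{\mathsf{rel}}_{\sigma^2}\Big(P,\frac1n\sum_{i=1}^n\delta_{y_i}\Big),$$ where $W^{\mathsf{rel}}_{\sigma^2}$ is the relaxed entropic optimal transport distance. (The equality of argmax and argmin is understood as follows: a measure in $\mathcal{P}$ attains the maximum of the first objective over $\mathcal{P}$ if and only if it attains the minimum of the second objective over $\mathcal{P}$.)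
   Context: Notation: $\|\cdot\|$ is the Euclidean norm on $\mathbb{R}^d$ and $\delta_y$ is the Dirac mass at $y$. Gaussian deconvolution model: one observes $Y_i=X_i+Z_i$, $i=1,\dots,n$, where the $X_i$ have an unknown distribution $P^*$ on $\mathbb{R}^d$ with finite second moment, and the errors $Z_1,\dots,Z_n$ are independent of $X_1,\dots,X_n$ and are i.i.d. centered Gaussian $\mathcal{N}(0,\sigma^2 I_d)$ on $\mathbb{R}^d$, with $\sigma^2$ known. The density of $\mathcal{N}(0,\sigma^2 I_d)$ is denoted $\varphi_\sigma$, and for a probability measure $P$ on $\mathbb{R}^d$, $$(\varphi_\sigma\star \mathrm{d}P)(y)=\int\varphi_\sigma(y-x)\,\mathrm{d}P(x).$$ The statement concerns an arbitrary realization $y_1,\dots,y_n$ of the observations; $P^*$ is not required to belong to $\mathcal{P}$. A class $\mathcal{P}$ is closed under domination if $Q\ll P$ for some $P\in\mathcal{P}$ implies $Q\in\mathcal{P}$; this is not assumed here. Kullback–Leibler divergence: $D(\mu\,\|\,\nu)=\int\log\frac{\mathrm{d}\mu}{\mathrm{d}\nu}\,\mathrm{d}\mu$ if $\mu\ll\nu$, and $+\infty$ otherwise. For a probability measure $\gamma$ on $\mathbb{R}^d\times\mathbb{R}^d$, $\pi_X\gamma$ and $\pi_Y\gamma$ denote its first and second marginals, and $I(\gamma)=D(\gamma\,\|\,\pi_X\gamma\otimes\pi_Y\gamma)$ is the mutual information. Let $\mathcal{M}(\nu)=\{\gamma:\pi_Y\gamma=\nu\}$. Relaxed entropic optimal transport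 distance: for probability measures $\mu,\nu$ on $\mathbb{R}^d$, $$W^{\mathsf{rel}}_{\sigma^2}(\mu,\nu)=\min_{\substack{\gamma\in\mathcal{M}(\nu)\\ \pi_X\gamma\ll\mu}}\int\frac12\|x-y\|^2\,\mathrm{d}\gamma(x,y)+\sigma^2\big[I(\gamma)+D(\pi_X\gamma\,\|\,\mu)\big].$$ *)

theory Defs
  imports "HOL-Probability.Probability"
begin

definition prob_measures_2 :: "'a::euclidean_space measure set" where
  "prob_measures_2 =
     {P. prob_space P \<and> sets P = sets borel \<and> integrable P (\<lambda>x. (norm x)\<^sup>2)}"

definition gauss_density :: "real \<Rightarrow> 'a::euclidean_space \<Rightarrow> real" where
  "gauss_density \<sigma> x =
     (2 * pi * \<sigma>\<^sup>2) powr (- (real DIM('a) / 2)) * exp (- ((norm x)\<^sup>2 / (2 * \<sigma>\<^sup>2)))"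

lemma gauss_density_eq_prod:
  fixes x :: "'a::euclidean_space"
  assumes "\<sigma> > 0"
  shows "gauss_density \<sigma> x = (\<Prod>b\<in>Basis. normal_density 0 \<sigma> (x \<bullet> b))"
proof -
  have pos: "2 * pi * \<sigma>\<^sup>2 > 0"
    using assms by simp
  have "(\<Prod>b\<in>Basis. normal_density 0 \<sigma> (x \<bullet> b)) =
      (1 / sqrt (2 * pi * \<sigma>\<^sup>2)) ^ DIM('a) * (\<Prod>b\<in>Basis. exp (- (x \<bullet> b)\<^sup>2 / (2 * \<sigma>\<^sup>2)))"
    unfolding normal_density_def diff_0_right prod.distrib prod_constant ..
  also have "(1 / sqrt (2 * pi * \<sigma>\<^sup>2)) ^ DIM('a) = (2 * pi * \<sigma>\<^sup>2) powr (- (real DIM('a) / 2))"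
  proof -
    have "1 / sqrt (2 * pi * \<sigma>\<^sup>2) = (2 * pi * \<sigma>\<^sup>2) powr (- (1 / 2))"
      using pos by (simp only: powr_minus powr_half_sqrt less_imp_le inverse_eq_divide)
    then have "(1 / sqrt (2 * pi * \<sigma>\<^sup>2)) ^ DIM('a) = ((2 * pi * \<sigma>\<^sup>2) powr (- (1 / 2))) powr real DIM('a)"
      using pos by (simp only: powr_realpow powr_gt_zero)
    also have "\<dots> = (2 * pi * \<sigma>\<^sup>2) powr (- (real DIM('a) / 2))"
      by (simp only: powr_powr) simp
    finally show ?thesis .
  qed
  also have "(\<Prod>b\<in>Basis. exp (- (x \<bullet> b)\<^sup>2 / (2 * \<sigma>\<^sup>2))) = exp (- ((norm x)\<^sup>2 / (2 * \<sigma>\<^sup>2)))"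
  proof -
    have "(norm x)\<^sup>2 = (\<Sum>b\<in>Basis. (x \<bullet> b)\<^sup>2)"
      unfolding power2_norm_eq_inner by (subst euclidean_inner) (simp add: power2_eq_square)
    then show ?thesis
      by (simp add: exp_sum [symmetric] sum_negf sum_divide_distrib)
  qed
  finally show ?thesis
    by (simp only: gauss_density_def)
qed

definition gauss_conv :: "real \<Rightarrow> 'a::euclidean_space measure \<Rightarrow> 'a \<Rightarrow> real" where
  "gauss_conv \<sigma> P y = (\<integral>x. gauss_density \<sigma> (y - x) \<partial>P)"

definition log_likelihood ::
  "real \<Rightarrow> nat \<Rightarrow> (nat \<Rightarrow> 'a::euclidean_space) \<Rightarrow> 'a measure \<Rightarrow> real" where
  "log_likelihood \<sigma> n y P = (\<Sum>i=1..n. ln (gauss_conv \<sigma> P (y i)))"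

definition empirical_measure :: "nat \<Rightarrow> (nat \<Rightarrow> 'a::euclidean_space) \<Rightarrow> 'a measure" where
  "empirical_measure n y =
     measure_of UNIV (sets borel)
       (\<lambda>A. ennreal (1 / real n) * (\<Sum>i=1..n. emeasure (return borel (y i)) A))"

lemma sets_empirical_measure [simp, measurable_cong]:
  "sets (empirical_measure n y) = sets borel"
  unfolding empirical_measure_def
  by (metis sets.sets_measure_of_eq space_borel)

text \<open>The function given to \<^const>\<open>measure_of\<close> above is indeed countably additive.\<close>

lemma emeasure_empirical_measure:
  assumes "A \<in> sets borel"
  shows "emeasure (empirical_measure n y) A =
    ennreal (1 / real n) * (\<Sum>i=1..n. emeasure (return borel (y i)) A)"
proof (rule emeasure_measure_of [OF empirical_measure_def])
  show "sets borel \<subseteq> Pow (UNIV :: 'a set)" by simp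
  show "positive (sets (empirical_measure n y))
      (\<lambda>A. ennreal (1 / real n) * (\<Sum>i=1..n. emeasure (return borel (y i)) A))"
    by (simp add: positive_def)
  show "countably_additive (sets (empirical_measure n y))
      (\<lambda>A. ennreal (1 / real n) * (\<Sum>i=1..n. emeasure (return borel (y i)) A))"
  proof (rule countably_additiveI)
    fix B :: "nat \<Rightarrow> 'a set"
    assume B: "range B \<subseteq> sets (empirical_measure n y)" "disjoint_family B"
    have "(\<Sum>j. ennreal (1 / real n) * (\<Sum>i=1..n. emeasure (return borel (y i)) (B j))) =
        ennreal (1 / real n) * (\<Sum>i=1..n. \<Sum>j. emeasure (return borel (y i)) (B j))"
      by (simp add: ennreal_suminf_cmult suminf_sum)
    also have "\<dots> = ennreal (1 / real n) * (\<Sum>i=1..n. emeasure (return borel (y i)) (\<Union>j. B j))"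
      using B by (intro arg_cong2 [where f = "(*)"] sum.cong refl suminf_emeasure) auto
    finally show "(\<Sum>j. ennreal (1 / real n) * (\<Sum>i=1..n. emeasure (return borel (y i)) (B j))) =
        ennreal (1 / real n) * (\<Sum>i=1..n. emeasure (return borel (y i)) (\<Union>j. B j))" .
  qed
  show "A \<in> sets (empirical_measure n y)" using assms by simp
qed

text \<open>
  \<^term>\<open>KL_div \<mu> \<nu>\<close> is $D(\mu\,\|\,\nu)$, with values in the extended reals; the library's
  \<^const>\<open>KL_divergence\<close> is real-valued and equals 0 when the integral diverges.
  Mind the argument order: \<^term>\<open>absolutely_continuous \<nu> \<mu>\<close> is $\mu \ll \nu$ and
  \<^term>\<open>RN_deriv \<nu> \<mu>\<close> is $d\mu/d\nu$.  The integral is the integral of the positive part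
  minus that of the negative part (\<^const>\<open>ennreal\<close> maps negative numbers to 0); the latter is
  always finite for probability measures.
\<close>

definition KL_div :: "'b measure \<Rightarrow> 'b measure \<Rightarrow> ereal" where
  "KL_div \<mu> \<nu> =
     (if absolutely_continuous \<nu> \<mu> then
        enn2ereal (\<integral>\<^sup>+x. ennreal (ln (enn2real (RN_deriv \<nu> \<mu> x))) \<partial>\<mu>)
        - enn2ereal (\<integral>\<^sup>+x. ennreal (- ln (enn2real (RN_deriv \<nu> \<mu> x))) \<partial>\<mu>)
      else \<infinity>)"

definition marginal_X :: "('a::euclidean_space \<times> 'a) measure \<Rightarrow> 'a measure" where
  "marginal_X \<gamma> = distr \<gamma> borel fst"

definition marginal_Y :: "('a::euclidean_space \<times> 'a) measure \<Rightarrow> 'a measure" where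
  "marginal_Y \<gamma> = distr \<gamma> borel snd"

definition mutual_info :: "('a::euclidean_space \<times> 'a) measure \<Rightarrow> ereal" where
  "mutual_info \<gamma> = KL_div \<gamma> (marginal_X \<gamma> \<Otimes>\<^sub>M marginal_Y \<gamma>)"

definition half_couplings :: "'a::euclidean_space measure \<Rightarrow> ('a \<times> 'a) measure set" where
  "half_couplings \<nu> =
     {\<gamma>. prob_space \<gamma> \<and> sets \<gamma> = sets (borel \<Otimes>\<^sub>M borel) \<and> marginal_Y \<gamma> = \<nu>}"

text \<open>
  The minimum in the definition of the relaxed distance is written as an infimum in the extended
  reals.  Both divergences are nonnegative here, so the sum never has the form $\infty - \infty$.
\<close>

definition W_rel :: "real \<Rightarrow> 'a::euclidean_space measure \<Rightarrow> 'a measure \<Rightarrow> ereal" where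
  "W_rel s \<mu> \<nu> =
     (INF \<gamma> \<in> {\<gamma> \<in> half_couplings \<nu>. absolutely_continuous \<mu> (marginal_X \<gamma>)}.
        enn2ereal (\<integral>\<^sup>+(x, y). ennreal (1 / 2 * (norm (x - y))\<^sup>2) \<partial>\<gamma>)
        + ereal s * (mutual_info \<gamma> + KL_div (marginal_X \<gamma>) \<mu>))"

end

theory Submission
  imports Defs
begin

text \<open>
  By the chain rule the divergence terms of the relaxed cost add up to the divergence of $\gamma$
  from $P \otimes \nu$, so the cost of $\gamma$ is
  $\sigma^2 D(\gamma \,\|\, e^{-c/\sigma^2} (P \otimes \nu))$ with $c(x,y) = \|x-y\|^2/2$.
  Gibbs' variational principle, applied for each $y$ separately, shows that it is minimised by the
  posterior law of $X$ given $Y = y$ under the prior $P$, and that the minimum is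
  $-\sigma^2 \int \log (\varphi_\sigma \star dP) \, d\nu$ up to a constant which does not depend
  on $P$.  For the empirical measure this is a decreasing affine function of the log-likelihood.
\<close>

section \<open>Divergences as integrals of logarithms of densities\<close>

text \<open>From \<open>ln s \<le> s - 1\<close> at \<open>s = 1/t\<close> one gets
  \<open>t * (- ln t) \<le> 1 - t \<le> 1\<close> for positive \<open>t\<close>; at
  \<open>t = 0\<close> the left side is 0. This keeps the negative part of a divergence
  finite.\<close>

lemma nn_integral_neg_ln_density_le:
  fixes g :: "'b \<Rightarrow> real"
  assumes [measurable]: "g \<in> borel_measurable N" and "\<And>x. 0 \<le> g x"
  shows "(\<integral>\<^sup>+x. ennreal (- ln (g x)) \<partial>density N g) \<le> emeasure N (space N)"
proof -
  have "g x * (- ln (g x)) \<le> 1" for x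
  proof (cases "g x = 0")
    case False
    with assms(2)[of x] have pos: "0 < g x" by simp
    then have "- ln (g x) \<le> 1 / g x - 1"
      using ln_le_minus_one[of "1 / g x"] by (simp add: ln_div)
    with pos have "g x * (- ln (g x)) \<le> g x * (1 / g x)"
      by (intro mult_left_mono) auto
    with pos show ?thesis by simp
  qed simp
  then have "ennreal (g x) * ennreal (- ln (g x)) \<le> 1" for x
    using assms(2) by (metis ennreal_le_1 ennreal_mult')
  then have "(\<integral>\<^sup>+x. ennreal (- ln (g x)) \<partial>density N g) \<le> (\<integral>\<^sup>+x. 1 \<partial>N)"
    by (subst nn_integral_density) (auto intro!: nn_integral_mono simp del: nn_integral_const)
  then show ?thesis by simp
qed

text \<open>The negative part \<open>q\<close> is at most 1, so the difference defining
  \<open>KL_div\<close> is never of the form \<open>\<infinity> - \<infinity>\<close>, and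
  integrability of the logarithm fails exactly when the positive part \<open>p\<close> is infinite.
  From here on divergences are handled as Bochner integrals.\<close>

lemma KL_div_density:
  fixes g :: "'b \<Rightarrow> real"
  assumes "prob_space N" and [measurable]: "g \<in> borel_measurable N" and nonneg: "\<And>x. 0 \<le> g x"
  shows "KL_div (density N g) N =
    (if integrable (density N g) (\<lambda>x. ln (g x)) then ereal (\<integral>x. ln (g x) \<partial>density N g) else \<infinity>)"
proof -
  interpret N: prob_space N by fact
  let ?M = "density N g"
  have ac: "absolutely_continuous N ?M"
    by (rule absolutely_continuousI_density) simp
  have "AE x in N. ennreal (g x) = RN_deriv N ?M x"
    by (rule N.RN_deriv_unique) auto
  \<comment> \<open>The integrals in \<open>KL_div\<close> are taken under \<open>?M\<close>, so the
    identity valid \<open>N\<close>-almost everywhere is moved there by absolute continuity.\<close>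
  then have RN: "AE x in ?M. ennreal (g x) = RN_deriv N ?M x"
    by (intro absolutely_continuous_AE[OF _ ac]) auto
  define p where "p = (\<integral>\<^sup>+x. ennreal (ln (g x)) \<partial>?M)"
  define q where "q = (\<integral>\<^sup>+x. ennreal (- ln (g x)) \<partial>?M)"
  have "q \<le> 1"
    using nn_integral_neg_ln_density_le[of g N] nonneg by (simp add: q_def N.emeasure_space_1)
  then have q: "q \<noteq> \<infinity>" by (auto simp: top_unique)
  have RN_p: "(\<integral>\<^sup>+x. ennreal (ln (enn2real (RN_deriv N ?M x))) \<partial>?M) = p"
    unfolding p_def using RN nonneg
    by (intro nn_integral_cong_AE) (auto elim!: eventually_mono, metis enn2real_ennreal)
  have RN_q: "(\<integral>\<^sup>+x. ennreal (- ln (enn2real (RN_deriv N ?M x))) \<partial>?M) = q"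
    unfolding q_def using RN nonneg
    by (intro nn_integral_cong_AE) (auto elim!: eventually_mono, metis enn2real_ennreal)
  have KL: "KL_div ?M N = enn2ereal p - enn2ereal q"
    by (simp add: KL_div_def ac RN_p RN_q)
  show ?thesis
  proof (cases "p = \<infinity>")
    case True
    then have "\<not> integrable ?M (\<lambda>x. ln (g x))"
      by (simp add: real_integrable_def p_def)
    moreover have "enn2ereal p - enn2ereal q = \<infinity>"
      using True q by (cases q) auto
    ultimately show ?thesis by (simp add: KL)
  next
    case False
    then have int: "integrable ?M (\<lambda>x. ln (g x))"
      using q by (auto simp: real_integrable_def p_def q_def)
    have "enn2ereal p - enn2ereal q = ereal (enn2real p - enn2real q)"
      using False q by (cases p; cases q) auto
    with int show ?thesis
      by (simp add: KL real_lebesgue_integral_def p_def q_def)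
  qed
qed

text \<open>A real version of the Radon-Nikodym derivative, nonnegative everywhere, allows pointwise
  computations with \<open>ln\<close>.\<close>

lemma absolutely_continuous_densityE:
  assumes "prob_space N" "prob_space M" "absolutely_continuous N M" "sets M = sets N"
  obtains g :: "'b \<Rightarrow> real" where
    "g \<in> borel_measurable N" "\<And>x. 0 \<le> g x" "M = density N g"
proof -
  interpret N: prob_space N by fact
  interpret M: prob_space M by fact
  obtain D where D: "D \<in> borel_measurable N" "AE x in N. RN_deriv N M x = ennreal (D x)"
      "\<And>x. 0 \<le> D x"
    using N.real_RN_deriv[OF M.finite_measure_axioms assms(3,4)] by metis
  have "M = density N (RN_deriv N M)"
    using N.density_RN_deriv[OF assms(3,4)] by simp
  also have "\<dots> = density N D"
    using D by (intro density_cong) auto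
  finally show ?thesis using that D by blast
qed

lemma KL_div_neq_MInfty:
  fixes M N :: "'b measure"
  assumes "prob_space N" "prob_space M" "sets M = sets N"
  shows "KL_div M N \<noteq> -\<infinity>"
proof (cases "absolutely_continuous N M")
  case True
  obtain g :: "'b \<Rightarrow> real" where "g \<in> borel_measurable N" "\<And>x. 0 \<le> g x" "M = density N g"
    by (rule absolutely_continuous_densityE[OF assms(1,2) True assms(3)]) (rule that)
  then show ?thesis using KL_div_density[OF assms(1), of g] by simp
qed (simp add: KL_div_def)

text \<open>The negative part of \<open>ln g\<close> has integral at most 1 in any case, so a
  one-sided bound settles integrability.\<close>

lemma integrable_ln_density:
  fixes g :: "'b \<Rightarrow> real"
  assumes "prob_space N" "prob_space (density N g)"
    and [measurable]: "g \<in> borel_measurable N" and "\<And>x. 0 \<le> g x"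
    and bound: "AE x in density N g. ln (g x) \<le> C"
  shows "integrable (density N g) (\<lambda>x. ln (g x))"
proof -
  interpret N: prob_space N by fact
  interpret M: prob_space "density N g" by fact
  have "(\<integral>\<^sup>+x. ennreal (- ln (g x)) \<partial>density N g) \<le> 1"
    using nn_integral_neg_ln_density_le[of g N] assms(4) by (simp add: N.emeasure_space_1)
  moreover have "(\<integral>\<^sup>+x. ennreal (ln (g x)) \<partial>density N g) \<le> (\<integral>\<^sup>+x. ennreal C \<partial>density N g)"
    using bound by (intro nn_integral_mono_AE) (auto elim!: eventually_mono intro: ennreal_leI)
  then have "(\<integral>\<^sup>+x. ennreal (ln (g x)) \<partial>density N g) \<le> ennreal C"
    using M.emeasure_space_1 by simp
  ultimately show ?thesis
    by (auto simp: real_integrable_def top_unique)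
qed

text \<open>Jensen's inequality in elementary form: \<open>1 - u \<le> exp (- u)\<close> is
  integrated. With \<open>u\<close> a log density this is the nonnegativity of a divergence.\<close>

lemma (in prob_space) expectation_nonneg_if_exp_neg_le_1:
  fixes u :: "'a \<Rightarrow> real"
  assumes u: "integrable M u" and exp: "(\<integral>\<^sup>+x. ennreal (exp (- u x)) \<partial>M) \<le> 1"
  shows "0 \<le> expectation u"
proof -
  have [measurable]: "u \<in> borel_measurable M" using u by simp
  have int: "integrable M (\<lambda>x. exp (- u x))"
    using exp by (intro integrableI_bounded) (auto simp: order_le_less_trans)
  then have "ennreal (expectation (\<lambda>x. exp (- u x))) \<le> 1"
    using exp by (simp add: nn_integral_eq_integral)
  then have "expectation (\<lambda>x. exp (- u x)) \<le> 1" by simp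
  moreover have "expectation (\<lambda>x. 1 - u x) \<le> expectation (\<lambda>x. exp (- u x))"
    using u int by (intro integral_mono) (auto simp: exp_ge_add_one_self[of "- _", simplified])
  ultimately show ?thesis using u by (simp add: prob_space)
qed

section \<open>Integration against the empirical measure\<close>

lemma measurable_uniform_count_measure:
  assumes "\<And>a. a \<in> A \<Longrightarrow> f a \<in> space N"
  shows "f \<in> measurable (uniform_count_measure A) N"
  using assms by (auto simp: measurable_def space_uniform_count_measure sets_uniform_count_measure)

text \<open>Coinciding observations are counted with multiplicity on both sides, through the
  cardinality of the preimage. In this form integrals and almost-everywhere statements transfer from
  the finite index set by change of variables.\<close>

lemma empirical_measure_eq_distr:
  assumes "n \<ge> 1"
  shows "empirical_measure n y = distr (uniform_count_measure {1..n}) borel y"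
proof (rule measure_eqI)
  fix A assume "A \<in> sets (empirical_measure n y)"
  then have A: "A \<in> sets borel" by simp
  have meas: "y \<in> measurable (uniform_count_measure {1..n}) borel"
    by (rule measurable_uniform_count_measure) simp
  have "emeasure (distr (uniform_count_measure {1..n}) borel y) A =
      ennreal (real (card (y -` A \<inter> {1..n})) / real n)"
    using A meas by (simp add: emeasure_distr emeasure_uniform_count_measure space_uniform_count_measure)
  moreover have "(\<Sum>i=1..n. indicator A (y i) :: ennreal) = ennreal (real (card (y -` A \<inter> {1..n})))"
    by (simp add: indicator_def sum.If_cases ennreal_of_nat_eq_real_of_nat vimage_def Int_commute)
  ultimately show "emeasure (empirical_measure n y) A =
      emeasure (distr (uniform_count_measure {1..n}) borel y) A"
    using A by (simp add: emeasure_empirical_measure ennreal_mult'[symmetric])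
qed simp

lemma
  fixes f :: "'a::euclidean_space \<Rightarrow> real"
  assumes "n \<ge> 1" and [measurable]: "f \<in> borel_measurable borel"
  shows integrable_empirical_measure: "integrable (empirical_measure n y) f"
    and integral_empirical_measure: "(\<integral>x. f x \<partial>empirical_measure n y) = (\<Sum>i=1..n. f (y i)) / real n"
proof -
  have meas: "y \<in> measurable (uniform_count_measure {1..n}) borel"
    by (rule measurable_uniform_count_measure) simp
  have "integrable (uniform_count_measure {1..n}) (\<lambda>i. f (y i))"
    unfolding uniform_count_measure_def by (rule integrable_point_measure_finite) simp
  then show "integrable (empirical_measure n y) f"
    unfolding empirical_measure_eq_distr[OF assms(1)] using meas by (subst integrable_distr_eq) auto
  show "(\<integral>x. f x \<partial>empirical_measure n y) = (\<Sum>i=1..n. f (y i)) / real n"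
    unfolding empirical_measure_eq_distr[OF assms(1)]
    using meas by (subst integral_distr) (auto simp: integral_uniform_count_measure)
qed

lemma prob_space_empirical_measure:
  assumes "n \<ge> 1"
  shows "prob_space (empirical_measure n y)"
  unfolding empirical_measure_eq_distr[OF assms]
  using assms by (intro prob_space.prob_space_distr prob_space_uniform_count_measure
      measurable_uniform_count_measure) auto

lemma AE_empirical_measureI:
  assumes "n \<ge> 1" "{x. Q x} \<in> sets borel" "\<And>i. i \<in> {1..n} \<Longrightarrow> Q (y i)"
  shows "AE x in empirical_measure n y. Q x"
  unfolding empirical_measure_eq_distr[OF assms(1)]
  using assms by (subst AE_distr_iff)
    (auto intro!: AE_I2 measurable_uniform_count_measure simp: space_uniform_count_measure)

section \<open>The Gaussian density and its convolution with a prior\<close>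

lemma gauss_density_pos: "\<sigma> > 0 \<Longrightarrow> 0 < gauss_density \<sigma> x"
  by (simp add: gauss_density_def)

lemma gauss_density_le:
  fixes x :: "'a::euclidean_space"
  shows "gauss_density \<sigma> x \<le> gauss_density \<sigma> (0::'a)"
  by (simp add: gauss_density_def mult_left_le)

lemma borel_measurable_gauss_density [measurable]: "gauss_density \<sigma> \<in> borel_measurable borel"
  unfolding gauss_density_def[abs_def] by measurable

lemma ln_gauss_density:
  fixes x :: "'a::euclidean_space"
  assumes "\<sigma> > 0"
  shows "ln (gauss_density \<sigma> x) = ln (gauss_density \<sigma> (0::'a)) - 1 / 2 * (norm x)\<^sup>2 / \<sigma>\<^sup>2"
  using assms by (simp add: gauss_density_def ln_mult)

lemma integrable_gauss_density:
  fixes P :: "'a::euclidean_space measure"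
  assumes "prob_space P" "sets P = sets borel" "\<sigma> > 0"
  shows "integrable P (\<lambda>x. gauss_density \<sigma> (y - x))"
proof -
  interpret P: prob_space P by fact
  have [measurable_cong]: "sets P = sets borel" by fact
  show ?thesis
    using assms(3)
    by (intro P.integrable_const_bound[where B = "gauss_density \<sigma> (0::'a)"])
      (auto simp: gauss_density_le gauss_density_pos less_imp_le)
qed

text \<open>The integrand is positive everywhere and bounded. Strictness matters because
  \<open>gauss_conv\<close> is divided by, and because \<open>ln 0 = 0\<close> would distort the
  log-likelihood.\<close>

lemma gauss_conv_pos:
  fixes P :: "'a::euclidean_space measure"
  assumes "prob_space P" "sets P = sets borel" "\<sigma> > 0"
  shows "0 < gauss_conv \<sigma> P y"
proof -
  interpret P: prob_space P by fact
  have int: "integrable P (\<lambda>x. gauss_density \<sigma> (y - x))"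
    using assms by (rule integrable_gauss_density)
  show ?thesis
    unfolding gauss_conv_def
    by (rule P.expectation_greater[OF int]) (simp add: assms(3) gauss_density_pos)
qed

lemma borel_measurable_gauss_conv:
  fixes P :: "'a::euclidean_space measure"
  assumes "prob_space P" "sets P = sets borel"
  shows "gauss_conv \<sigma> P \<in> borel_measurable borel"
proof -
  interpret P: prob_space P by fact
  have [measurable_cong]: "sets P = sets borel" by fact
  show ?thesis
    unfolding gauss_conv_def[abs_def] by measurable
qed

section \<open>Gibbs' inequality for the two entropy terms\<close>

text \<open>
  Since \<^term>\<open>ln (0::real) = 0\<close> by convention, the bounds \<open>r_le\<close> and \<open>h_le\<close> in the proof hold
  without any positivity of \<open>r\<close> and \<open>h\<close>.
\<close>

lemma gibbs_entropy_sum_ge: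
  fixes f r :: "'b \<times> 'c \<Rightarrow> real" and h :: "'b \<Rightarrow> real"
  assumes "prob_space P" "prob_space \<nu>" "prob_space (density P h)"
    and [measurable]: "h \<in> borel_measurable P" "r \<in> borel_measurable (P \<Otimes>\<^sub>M \<nu>)"
      "f \<in> borel_measurable (P \<Otimes>\<^sub>M \<nu>)"
    and nonneg: "\<And>x. 0 \<le> h x" "\<And>p. 0 \<le> r p" "\<And>p. 0 < f p"
    and f_le: "\<And>y. (\<integral>\<^sup>+x. ennreal (f (x, y)) \<partial>P) \<le> 1"
    and \<gamma>: "\<gamma> = density (density P h \<Otimes>\<^sub>M \<nu>) r" "prob_space \<gamma>"
    and int: "integrable \<gamma> (\<lambda>p. ln (f p))" "integrable \<gamma> (\<lambda>p. ln (r p))"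
      "integrable \<gamma> (\<lambda>p. ln (h (fst p)))"
  shows "(\<integral>p. ln (f p) \<partial>\<gamma>) \<le> (\<integral>p. ln (r p) \<partial>\<gamma>) + (\<integral>p. ln (h (fst p)) \<partial>\<gamma>)"
proof -
  interpret P: prob_space P by fact
  interpret \<nu>: prob_space \<nu> by fact
  interpret H: prob_space "density P h" by fact
  interpret \<gamma>: prob_space \<gamma> by fact
  interpret pair_sigma_finite "density P h" \<nu> ..
  \<comment> \<open>By the chain rule \<open>r p * h (fst p)\<close> is the density of
    \<open>\<gamma>\<close> with respect to \<open>P \<Otimes>\<^sub>M \<nu>\<close>. Where it is
    positive, \<open>u\<close> is the logarithm of its ratio to \<open>f\<close>, and the claim is
    that \<open>u\<close> has nonnegative expectation.\<close>
  define u where "u p = ln (r p) + ln (h (fst p)) - ln (f p)" for p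
  have sets_pair [measurable_cong]: "sets (density P h \<Otimes>\<^sub>M \<nu>) = sets (P \<Otimes>\<^sub>M \<nu>)"
    by (intro sets_pair_measure_cong) auto
  have [measurable]: "u \<in> borel_measurable (P \<Otimes>\<^sub>M \<nu>)"
    unfolding u_def[abs_def] by measurable
  \<comment> \<open>The factors \<open>exp (- ln _)\<close> are not written as reciprocals, since
    \<open>r\<close> and \<open>h\<close> may vanish; only \<open>f\<close> is known to be
    positive.\<close>
  have exp_u: "exp (- u p) = f p * exp (- ln (r p)) * exp (- ln (h (fst p)))" for p
    using nonneg(3)[of p] by (simp add: u_def exp_diff exp_minus exp_add field_simps)
  have r_le: "r p * exp (- ln (r p)) \<le> 1" for p
    using nonneg(2)[of p] by (cases "r p = 0") (simp_all add: exp_minus)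
  have h_le: "h x * exp (- ln (h x)) \<le> 1" for x
    using nonneg(1)[of x] by (cases "h x = 0") (simp_all add: exp_minus)
  have "(\<integral>\<^sup>+p. ennreal (exp (- u p)) \<partial>\<gamma>) =
      (\<integral>\<^sup>+p. ennreal (r p) * ennreal (exp (- u p)) \<partial>(density P h \<Otimes>\<^sub>M \<nu>))"
    unfolding \<gamma>(1) by (subst nn_integral_density) auto
  also have "\<dots> \<le> (\<integral>\<^sup>+p. ennreal (f p * exp (- ln (h (fst p)))) \<partial>(density P h \<Otimes>\<^sub>M \<nu>))"
  proof (rule nn_integral_mono)
    fix p
    have "r p * exp (- u p) = (r p * exp (- ln (r p))) * (f p * exp (- ln (h (fst p))))"
      by (simp add: exp_u)
    also have "\<dots> \<le> 1 * (f p * exp (- ln (h (fst p))))"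
      using r_le[of p] nonneg(3)[of p] by (intro mult_right_mono) auto
    finally show "ennreal (r p) * ennreal (exp (- u p)) \<le> ennreal (f p * exp (- ln (h (fst p))))"
      using nonneg(2)[of p] by (simp add: ennreal_mult'[symmetric] ennreal_leI)
  qed
  \<comment> \<open>The variable \<open>x\<close> is integrated first because \<open>f\<close> is
    normalised in \<open>x\<close> for each fixed \<open>y\<close>.\<close>
  also have "\<dots> = (\<integral>\<^sup>+y. \<integral>\<^sup>+x. ennreal (f (x, y) * exp (- ln (h x))) \<partial>density P h \<partial>\<nu>)"
    by (subst nn_integral_snd[symmetric]) auto
  also have "\<dots> \<le> (\<integral>\<^sup>+y. 1 \<partial>\<nu>)"
  proof (rule nn_integral_mono)
    fix y assume [measurable]: "y \<in> space \<nu>"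
    have "(\<integral>\<^sup>+x. ennreal (f (x, y) * exp (- ln (h x))) \<partial>density P h) =
        (\<integral>\<^sup>+x. ennreal (h x) * ennreal (f (x, y) * exp (- ln (h x))) \<partial>P)"
      by (subst nn_integral_density) auto
    also have "\<dots> \<le> (\<integral>\<^sup>+x. ennreal (f (x, y)) \<partial>P)"
    proof (rule nn_integral_mono)
      fix x
      have "h x * (f (x, y) * exp (- ln (h x))) \<le> f (x, y)"
        using mult_right_mono[OF h_le[of x], of "f (x, y)"] nonneg(3)[of "(x, y)"]
        by (simp add: ac_simps)
      then show "ennreal (h x) * ennreal (f (x, y) * exp (- ln (h x))) \<le> ennreal (f (x, y))"
        using nonneg(1)[of x] by (simp add: ennreal_mult'[symmetric] ennreal_leI)
    qed
    finally show "(\<integral>\<^sup>+x. ennreal (f (x, y) * exp (- ln (h x))) \<partial>density P h) \<le> 1"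
      using f_le[of y] by simp
  qed
  finally have "(\<integral>\<^sup>+p. ennreal (exp (- u p)) \<partial>\<gamma>) \<le> 1"
    by (simp add: \<nu>.emeasure_space_1)
  then have "0 \<le> \<gamma>.expectation u"
    by (intro \<gamma>.expectation_nonneg_if_exp_neg_le_1) (auto simp: u_def[abs_def] int)
  then show ?thesis
    using int by (simp add: u_def[abs_def])
qed

section \<open>The posterior law\<close>

text \<open>
  The density with respect to \<open>P\<close> of the law of \<open>X\<close> given \<open>X + Z = y\<close>, for \<open>X\<close> with prior
  \<open>P\<close>; the argument is the pair \<open>(x, y)\<close>.
\<close>

definition posterior_density ::
  "real \<Rightarrow> 'a::euclidean_space measure \<Rightarrow> 'a \<times> 'a \<Rightarrow> real" where
  "posterior_density \<sigma> P p = gauss_density \<sigma> (snd p - fst p) / gauss_conv \<sigma> P (snd p)"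

text \<open>Bayes' formula: the denominator is the integral of the numerator over the prior, which
  gives mass 1 for each \<open>y\<close>. The logarithm is expanded so that it can later be solved
  for the quadratic cost.\<close>

lemma
  fixes P :: "'a::euclidean_space measure"
  assumes P: "prob_space P" "sets P = sets borel" and "\<sigma> > 0"
  shows posterior_density_pos: "0 < posterior_density \<sigma> P p"
    and borel_measurable_posterior_density:
      "posterior_density \<sigma> P \<in> borel_measurable (borel \<Otimes>\<^sub>M borel)"
    and nn_integral_posterior_density: "(\<integral>\<^sup>+x. ennreal (posterior_density \<sigma> P (x, y)) \<partial>P) = 1"
    and ln_posterior_density: "ln (posterior_density \<sigma> P p) =
      ln (gauss_density \<sigma> (0::'a)) - 1 / 2 * (norm (fst p - snd p))\<^sup>2 / \<sigma>\<^sup>2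
      - ln (gauss_conv \<sigma> P (snd p))"
proof -
  note [measurable] = borel_measurable_gauss_conv[OF P]
  have conv_pos: "0 < gauss_conv \<sigma> P z" for z
    using assms by (rule gauss_conv_pos)
  have pos: "0 < posterior_density \<sigma> P q" for q
    using assms conv_pos by (simp add: posterior_density_def gauss_density_pos)
  then show "0 < posterior_density \<sigma> P p" .
  show "posterior_density \<sigma> P \<in> borel_measurable (borel \<Otimes>\<^sub>M borel)"
    unfolding posterior_density_def[abs_def] by measurable
  have "(\<integral>\<^sup>+x. ennreal (posterior_density \<sigma> P (x, y)) \<partial>P) =
      ennreal (\<integral>x. posterior_density \<sigma> P (x, y) \<partial>P)"
    using assms pos
    by (intro nn_integral_eq_integral AE_I2 less_imp_le[OF pos])
      (simp add: posterior_density_def integrable_gauss_density)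
  also have "(\<integral>x. posterior_density \<sigma> P (x, y) \<partial>P) = 1"
    using conv_pos[of y] by (simp add: posterior_density_def gauss_conv_def)
  finally show "(\<integral>\<^sup>+x. ennreal (posterior_density \<sigma> P (x, y)) \<partial>P) = 1" by simp
  have "ln (posterior_density \<sigma> P p) =
      ln (gauss_density \<sigma> (snd p - fst p)) - ln (gauss_conv \<sigma> P (snd p))"
    using conv_pos[of "snd p"] gauss_density_pos[OF assms(3), of "snd p - fst p"]
    by (simp add: posterior_density_def ln_div)
  then show "ln (posterior_density \<sigma> P p) =
      ln (gauss_density \<sigma> (0::'a)) - 1 / 2 * (norm (fst p - snd p))\<^sup>2 / \<sigma>\<^sup>2
      - ln (gauss_conv \<sigma> P (snd p))"
    using ln_gauss_density[OF assms(3), of "snd p - fst p"] by (simp add: norm_minus_commute)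
qed

section \<open>The relaxed cost in terms of log densities\<close>

definition relaxed_cost ::
  "real \<Rightarrow> 'a::euclidean_space measure \<Rightarrow> ('a \<times> 'a) measure \<Rightarrow> ereal" where
  "relaxed_cost s \<mu> \<gamma> = enn2ereal (\<integral>\<^sup>+(x, y). ennreal (1 / 2 * (norm (x - y))\<^sup>2) \<partial>\<gamma>)
    + ereal s * (mutual_info \<gamma> + KL_div (marginal_X \<gamma>) \<mu>)"

text \<open>The closed form of the minimum. The first term comes from the Gaussian normalising
  constant and is the same for all \<open>P\<close>.\<close>

definition min_relaxed_cost ::
  "real \<Rightarrow> nat \<Rightarrow> (nat \<Rightarrow> 'a::euclidean_space) \<Rightarrow> 'a measure \<Rightarrow> real" where
  "min_relaxed_cost \<sigma> n y P =
    \<sigma>\<^sup>2 * ln (gauss_density \<sigma> (0::'a)) - \<sigma>\<^sup>2 / real n * log_likelihood \<sigma> n y P"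

lemma half_couplingsD:
  fixes \<gamma> :: "('a::euclidean_space \<times> 'a) measure"
  assumes "\<gamma> \<in> half_couplings \<nu>"
  shows "prob_space \<gamma>" "sets \<gamma> = sets (borel \<Otimes>\<^sub>M borel)" "marginal_Y \<gamma> = \<nu>"
    and "prob_space (marginal_X \<gamma>)"
proof -
  show \<gamma>: "prob_space \<gamma>" and S: "sets \<gamma> = sets (borel \<Otimes>\<^sub>M borel)" and "marginal_Y \<gamma> = \<nu>"
    using assms by (auto simp: half_couplings_def)
  have "fst \<in> measurable \<gamma> borel"
    unfolding measurable_cong_sets[OF S refl] by (rule measurable_fst)
  then show "prob_space (marginal_X \<gamma>)"
    unfolding marginal_X_def by (rule prob_space.prob_space_distr[OF \<gamma>])
qed

text \<open>The second marginal is prescribed, so the integral of a function of \<open>snd p\<close>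
  is the same for every admissible \<open>\<gamma>\<close>. This is how the log-likelihood separates
  from the minimisation.\<close>

lemma
  fixes \<gamma> :: "('a::euclidean_space \<times> 'a) measure"
  assumes "n \<ge> 1" and P: "prob_space P" "sets P = sets borel"
    and \<gamma>: "\<gamma> \<in> half_couplings (empirical_measure n y)"
  shows integrable_ln_gauss_conv_snd: "integrable \<gamma> (\<lambda>p. ln (gauss_conv \<sigma> P (snd p)))"
    and integral_ln_gauss_conv_snd:
      "(\<integral>p. ln (gauss_conv \<sigma> P (snd p)) \<partial>\<gamma>) = log_likelihood \<sigma> n y P / real n"
proof -
  note [measurable] = borel_measurable_gauss_conv[OF P]
  note [measurable_cong] = half_couplingsD(2)[OF \<gamma>]
  have \<nu>: "empirical_measure n y = distr \<gamma> borel snd"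
    using half_couplingsD(3)[OF \<gamma>] by (simp add: marginal_Y_def)
  have "integrable (distr \<gamma> borel snd) (\<lambda>z. ln (gauss_conv \<sigma> P z))"
    unfolding \<nu>[symmetric] using assms(1) by (rule integrable_empirical_measure) simp
  then show "integrable \<gamma> (\<lambda>p. ln (gauss_conv \<sigma> P (snd p)))"
    by (subst (asm) integrable_distr_eq) auto
  have "(\<integral>p. ln (gauss_conv \<sigma> P (snd p)) \<partial>\<gamma>) =
      (\<integral>z. ln (gauss_conv \<sigma> P z) \<partial>empirical_measure n y)"
    unfolding \<nu> by (subst integral_distr) auto
  also have "\<dots> = log_likelihood \<sigma> n y P / real n"
    using assms(1) by (simp add: integral_empirical_measure log_likelihood_def)
  finally show "(\<integral>p. ln (gauss_conv \<sigma> P (snd p)) \<partial>\<gamma>) = log_likelihood \<sigma> n y P / real n" .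
qed

text \<open>The quadratic cost is replaced by the log posterior, and the two divergences become
  integrals of \<open>ln r\<close> and \<open>ln h\<close>. The bracket that remains is the
  divergence of \<open>\<gamma>\<close> from the posterior coupling, so it measures the excess over
  the minimum.\<close>

lemma relaxed_cost_eq:
  fixes \<gamma> :: "('a::euclidean_space \<times> 'a) measure"
  assumes "n \<ge> 1" and "\<sigma> > 0" and P: "prob_space P" "sets P = sets borel"
    and \<gamma>: "\<gamma> \<in> half_couplings (empirical_measure n y)"
    and h: "h \<in> borel_measurable borel" "\<And>x. 0 \<le> h x" "marginal_X \<gamma> = density P h"
    and r: "r \<in> borel_measurable (borel \<Otimes>\<^sub>M borel)" "\<And>p. 0 \<le> r p"
      "\<gamma> = density (density P h \<Otimes>\<^sub>M empirical_measure n y) r"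
    and int: "integrable \<gamma> (\<lambda>p. ln (posterior_density \<sigma> P p))" "integrable \<gamma> (\<lambda>p. ln (r p))"
      "integrable \<gamma> (\<lambda>p. ln (h (fst p)))"
  shows "relaxed_cost (\<sigma>\<^sup>2) P \<gamma> = ereal (min_relaxed_cost \<sigma> n y P + \<sigma>\<^sup>2 *
    ((\<integral>p. ln (r p) \<partial>\<gamma>) + (\<integral>p. ln (h (fst p)) \<partial>\<gamma>) - (\<integral>p. ln (posterior_density \<sigma> P p) \<partial>\<gamma>)))"
proof -
  let ?\<nu> = "empirical_measure n y"
  note gc = integrable_ln_gauss_conv_snd[OF assms(1) P \<gamma>, of \<sigma>]
    integral_ln_gauss_conv_snd[OF assms(1) P \<gamma>, of \<sigma>]
  note [measurable] = h(1) r(1)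
  note [measurable_cong] = half_couplingsD(2)[OF \<gamma>] P(2)
  interpret \<gamma>: prob_space \<gamma> by (rule half_couplingsD[OF \<gamma>])
  interpret \<nu>: prob_space ?\<nu> using assms(1) by (rule prob_space_empirical_measure)
  interpret H: prob_space "density P h" using half_couplingsD(4)[OF \<gamma>] h(3) by simp
  interpret pair_prob_space "density P h" ?\<nu> ..
  define L where "L = ln (gauss_density \<sigma> (0::'a))"
  let ?c = "\<lambda>p::'a \<times> 'a. 1 / 2 * (norm (fst p - snd p))\<^sup>2"
  \<comment> \<open>The formula for the log posterior density, solved for the cost.\<close>
  have c_eq: "?c p = \<sigma>\<^sup>2 * (L - ln (gauss_conv \<sigma> P (snd p)) - ln (posterior_density \<sigma> P p))" for p
    using assms(2) by (simp add: ln_posterior_density[OF P assms(2)] L_def)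
  have int_c: "integrable \<gamma> ?c"
    unfolding c_eq using int(1) gc(1) by simp
  have c: "(\<integral>p. ?c p \<partial>\<gamma>) =
      \<sigma>\<^sup>2 * (L - log_likelihood \<sigma> n y P / real n - (\<integral>p. ln (posterior_density \<sigma> P p) \<partial>\<gamma>))"
    unfolding c_eq using int(1) gc by (simp add: \<gamma>.prob_space)
  have nn_c: "(\<integral>\<^sup>+(x, y). ennreal (1 / 2 * (norm (x - y))\<^sup>2) \<partial>\<gamma>) = ennreal (\<integral>p. ?c p \<partial>\<gamma>)"
    using nn_integral_eq_integral[OF int_c] by (simp add: case_prod_beta')
  have c_nonneg: "0 \<le> (\<integral>p. ?c p \<partial>\<gamma>)" by (rule integral_nonneg_AE) simp
  have MI: "mutual_info \<gamma> = ereal (\<integral>p. ln (r p) \<partial>\<gamma>)"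
  proof -
    have "mutual_info \<gamma> = KL_div (density (density P h \<Otimes>\<^sub>M ?\<nu>) r) (density P h \<Otimes>\<^sub>M ?\<nu>)"
      unfolding mutual_info_def half_couplingsD(3)[OF \<gamma>] h(3) using r(3) by simp
    also have "\<dots> = ereal (\<integral>p. ln (r p) \<partial>\<gamma>)"
      using int(2) r(2) by (subst KL_div_density) (auto simp: P.prob_space_axioms r(3)[symmetric])
    finally show ?thesis .
  qed
  have marg: "density P h = distr \<gamma> borel fst"
    using h(3) by (simp add: marginal_X_def)
  have "integrable (distr \<gamma> borel fst) (\<lambda>x. ln (h x))"
    using int(3) by (subst integrable_distr_eq) auto
  moreover have "(\<integral>x. ln (h x) \<partial>distr \<gamma> borel fst) = (\<integral>p. ln (h (fst p)) \<partial>\<gamma>)"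
    by (subst integral_distr) auto
  ultimately have KL: "KL_div (marginal_X \<gamma>) P = ereal (\<integral>p. ln (h (fst p)) \<partial>\<gamma>)"
    unfolding h(3) using h(2) by (subst KL_div_density) (auto simp: P(1) marg)
  show ?thesis
    unfolding relaxed_cost_def nn_c MI KL enn2ereal_ennreal[OF c_nonneg]
    unfolding c min_relaxed_cost_def
    by (simp add: L_def algebra_simps)
qed

section \<open>Lower bound for every admissible coupling\<close>

text \<open>An infinite cost is trivially large enough. A finite one forces each of its terms to be
  finite, which supplies the densities and the integrability for \<open>relaxed_cost_eq\<close>; the
  bracket there is nonnegative by Gibbs' inequality.\<close>

lemma relaxed_cost_ge:
  fixes \<gamma> :: "('a::euclidean_space \<times> 'a) measure"
  assumes "n \<ge> 1" and "\<sigma> > 0" and P: "prob_space P" "sets P = sets borel"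
    and \<gamma>: "\<gamma> \<in> half_couplings (empirical_measure n y)"
    and ac: "absolutely_continuous P (marginal_X \<gamma>)"
  shows "ereal (min_relaxed_cost \<sigma> n y P) \<le> relaxed_cost (\<sigma>\<^sup>2) P \<gamma>"
proof -
  let ?\<nu> = "empirical_measure n y" and ?c = "\<lambda>p::'a \<times> 'a. 1 / 2 * (norm (fst p - snd p))\<^sup>2"
  note gc = integrable_ln_gauss_conv_snd[OF assms(1) P \<gamma>, of \<sigma>]
  note [measurable_cong] = half_couplingsD(2)[OF \<gamma>] P(2)
  interpret \<gamma>: prob_space \<gamma> by (rule half_couplingsD[OF \<gamma>])
  interpret \<nu>: prob_space ?\<nu> using assms(1) by (rule prob_space_empirical_measure)
  have X: "prob_space (marginal_X \<gamma>)" "sets (marginal_X \<gamma>) = sets borel"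
    using half_couplingsD(4)[OF \<gamma>] by (auto simp: marginal_X_def)
  interpret X: prob_space "marginal_X \<gamma>" by (rule X)
  interpret XY: pair_prob_space "marginal_X \<gamma>" ?\<nu> ..
  have XY: "prob_space (marginal_X \<gamma> \<Otimes>\<^sub>M ?\<nu>)"
    by (rule XY.P.prob_space_axioms)
  have sets_XY: "sets (marginal_X \<gamma> \<Otimes>\<^sub>M ?\<nu>) = sets (borel \<Otimes>\<^sub>M borel)"
    using X(2) by (intro sets_pair_measure_cong) auto
  have MI: "mutual_info \<gamma> = KL_div \<gamma> (marginal_X \<gamma> \<Otimes>\<^sub>M ?\<nu>)"
    by (simp add: mutual_info_def half_couplingsD(3)[OF \<gamma>])
  have not_MInfty: "mutual_info \<gamma> \<noteq> -\<infinity>" "KL_div (marginal_X \<gamma>) P \<noteq> -\<infinity>"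
    unfolding MI
    using KL_div_neq_MInfty[OF XY \<gamma>.prob_space_axioms] KL_div_neq_MInfty[OF P(1) X(1)]
    by (simp_all add: half_couplingsD(2)[OF \<gamma>] sets_XY X(2) P(2))
  show ?thesis
  proof (cases "relaxed_cost (\<sigma>\<^sup>2) P \<gamma> = \<infinity>")
    case False
    \<comment> \<open>As neither divergence is \<open>-\<infinity>\<close> and
      \<open>\<sigma>\<^sup>2\<close> is positive, an infinite term would make the whole cost
      infinite.\<close>
    have fin: "(\<integral>\<^sup>+(x, y). ennreal (1 / 2 * (norm (x - y))\<^sup>2) \<partial>\<gamma>) \<noteq> \<infinity>"
        "mutual_info \<gamma> \<noteq> \<infinity>" "KL_div (marginal_X \<gamma>) P \<noteq> \<infinity>"
      using False not_MInfty assms(2) by (auto simp: relaxed_cost_def)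
    obtain h :: "'a \<Rightarrow> real" where h: "h \<in> borel_measurable P" "\<And>x. 0 \<le> h x"
        "marginal_X \<gamma> = density P h"
      using absolutely_continuous_densityE[OF P(1) X(1) ac] X(2) P(2) by metis
    have "absolutely_continuous (marginal_X \<gamma> \<Otimes>\<^sub>M ?\<nu>) \<gamma>"
      using fin(2) by (auto simp: MI KL_div_def split: if_splits)
    then obtain r :: "'a \<times> 'a \<Rightarrow> real" where r: "r \<in> borel_measurable (marginal_X \<gamma> \<Otimes>\<^sub>M ?\<nu>)"
        "\<And>p. 0 \<le> r p" "\<gamma> = density (marginal_X \<gamma> \<Otimes>\<^sub>M ?\<nu>) r"
      using absolutely_continuous_densityE[OF XY half_couplingsD(1)[OF \<gamma>]]
        half_couplingsD(2)[OF \<gamma>] sets_XY by metis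
    have h_borel [measurable]: "h \<in> borel_measurable borel"
      using h(1) by simp
    have r_borel [measurable]: "r \<in> borel_measurable (borel \<Otimes>\<^sub>M borel)"
      using r(1) unfolding measurable_cong_sets[OF sets_XY refl] .
    have int_r: "integrable \<gamma> (\<lambda>p. ln (r p))"
      using fin(2) KL_div_density[OF XY r(1,2)] unfolding MI r(3)[symmetric]
      by (auto split: if_splits)
    have "integrable (marginal_X \<gamma>) (\<lambda>x. ln (h x))"
      using fin(3) KL_div_density[OF P(1) h(1,2)] unfolding h(3)[symmetric]
      by (auto split: if_splits)
    then have int_h: "integrable \<gamma> (\<lambda>p. ln (h (fst p)))"
      unfolding marginal_X_def by (subst (asm) integrable_distr_eq) auto
    have "integrable \<gamma> ?c"
      using fin(1) by (intro integrableI_nonneg) (auto simp: case_prod_beta' less_top)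
    then have "integrable \<gamma> (\<lambda>p. ?c p / \<sigma>\<^sup>2)"
      by (rule integrable_divide)
    then have int_f: "integrable \<gamma> (\<lambda>p. ln (posterior_density \<sigma> P p))"
      unfolding ln_posterior_density[OF P assms(2)]
      by (intro Bochner_Integration.integrable_diff \<gamma>.integrable_const gc)
    have r': "\<gamma> = density (density P h \<Otimes>\<^sub>M ?\<nu>) r"
      using r(3) unfolding h(3) .
    have "(\<integral>p. ln (posterior_density \<sigma> P p) \<partial>\<gamma>) \<le>
        (\<integral>p. ln (r p) \<partial>\<gamma>) + (\<integral>p. ln (h (fst p)) \<partial>\<gamma>)"
      using posterior_density_pos[OF P assms(2)] nn_integral_posterior_density[OF P assms(2)]
        borel_measurable_posterior_density[OF P assms(2)] X(1) h(3)
      by (intro gibbs_entropy_sum_ge[OF P(1) \<nu>.prob_space_axioms _ h(1) _ _ h(2) r(2)] int_f int_r int_h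
          \<gamma>.prob_space_axioms r') auto
    then have "0 \<le> \<sigma>\<^sup>2 * ((\<integral>p. ln (r p) \<partial>\<gamma>) + (\<integral>p. ln (h (fst p)) \<partial>\<gamma>)
        - (\<integral>p. ln (posterior_density \<sigma> P p) \<partial>\<gamma>))"
      by simp
    then show ?thesis
      unfolding relaxed_cost_eq[OF assms(1,2) P \<gamma> h_borel h(2,3) r_borel r(2) r' int_f int_r int_h]
      by simp
  qed simp
qed

section \<open>The posterior coupling attains the bound\<close>

text \<open>Under \<open>\<gamma>\<close> the second coordinate has law \<open>\<nu>\<close> and the
  first is drawn from the posterior given the second. Averaging the posterior over
  \<open>\<nu>\<close> gives \<open>h\<close>, and dividing by \<open>h\<close> passes from
  \<open>P \<Otimes>\<^sub>M \<nu>\<close> to the product of the marginals, as mutual information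
  requires.\<close>

lemma density_posterior_half_coupling:
  fixes P :: "'a::euclidean_space measure"
  assumes P: "prob_space P" "sets P = sets borel" and "\<sigma> > 0"
    and \<nu>: "prob_space \<nu>" "sets \<nu> = sets borel"
    and h: "h \<in> borel_measurable borel" "\<And>x. 0 < h x"
      "\<And>x. (\<integral>\<^sup>+z. ennreal (posterior_density \<sigma> P (x, z)) \<partial>\<nu>) = ennreal (h x)"
  defines "\<gamma> \<equiv> density (P \<Otimes>\<^sub>M \<nu>) (posterior_density \<sigma> P)"
  shows "\<gamma> \<in> half_couplings \<nu>"
    and "marginal_X \<gamma> = density P h"
    and "\<gamma> = density (density P h \<Otimes>\<^sub>M \<nu>) (\<lambda>p. posterior_density \<sigma> P p / h (fst p))"
proof -
  let ?f = "posterior_density \<sigma> P"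
  interpret P: prob_space P by fact
  interpret \<nu>: prob_space \<nu> by fact
  interpret P\<nu>: pair_prob_space P \<nu> ..
  note [measurable_cong] = P(2) \<nu>(2)
  note [measurable] = h(1) borel_measurable_posterior_density[OF P assms(3)]
  have sets_\<gamma>: "sets \<gamma> = sets (borel \<Otimes>\<^sub>M borel)"
    unfolding \<gamma>_def sets_density using P(2) \<nu>(2) by (rule sets_pair_measure_cong)
  have [measurable_cong]: "sets \<gamma> = sets (borel \<Otimes>\<^sub>M borel)" by (rule sets_\<gamma>)
  have Y: "marginal_Y \<gamma> = \<nu>"
  proof (rule measure_eqI)
    fix A assume "A \<in> sets (marginal_Y \<gamma>)"
    then have [measurable]: "A \<in> sets borel" by (simp add: marginal_Y_def)
    have "emeasure (marginal_Y \<gamma>) A = (\<integral>\<^sup>+z. indicator A z \<partial>marginal_Y \<gamma>)"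
      by (simp add: marginal_Y_def)
    also have "\<dots> = (\<integral>\<^sup>+p. indicator A (snd p) \<partial>\<gamma>)"
      unfolding marginal_Y_def by (rule nn_integral_distr) auto
    also have "\<dots> = (\<integral>\<^sup>+p. ennreal (?f p) * indicator A (snd p) \<partial>(P \<Otimes>\<^sub>M \<nu>))"
      unfolding \<gamma>_def by (subst nn_integral_density) auto
    \<comment> \<open>Integrating over \<open>x\<close> first uses the total mass 1 of each
      posterior; the other marginal integrates over \<open>z\<close> first and picks up
      \<open>h\<close>.\<close>
    also have "\<dots> = (\<integral>\<^sup>+z. \<integral>\<^sup>+x. ennreal (?f (x, z)) * indicator A z \<partial>P \<partial>\<nu>)"
      by (subst P\<nu>.nn_integral_snd[symmetric]) auto
    also have "\<dots> = (\<integral>\<^sup>+z. indicator A z \<partial>\<nu>)"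
      by (intro nn_integral_cong) (simp add: nn_integral_multc nn_integral_posterior_density[OF P assms(3)])
    also have "\<dots> = emeasure \<nu> A" using \<nu>(2) by simp
    finally show "emeasure (marginal_Y \<gamma>) A = emeasure \<nu> A" .
  qed (simp add: marginal_Y_def \<nu>(2))
  have "prob_space \<gamma>"
  proof
    have "emeasure \<gamma> (space \<gamma>) = emeasure (marginal_Y \<gamma>) (space borel)"
      unfolding marginal_Y_def by (subst emeasure_distr) auto
    also have "\<dots> = 1"
      unfolding Y using \<nu>.emeasure_space_1 sets_eq_imp_space_eq[OF \<nu>(2)] by simp
    finally show "emeasure \<gamma> (space \<gamma>) = 1" .
  qed
  then show half: "\<gamma> \<in> half_couplings \<nu>"
    by (simp add: half_couplings_def sets_\<gamma> Y)
  show X: "marginal_X \<gamma> = density P h"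
  proof (rule measure_eqI)
    fix A assume "A \<in> sets (marginal_X \<gamma>)"
    then have [measurable]: "A \<in> sets borel" by (simp add: marginal_X_def)
    have "emeasure (marginal_X \<gamma>) A = (\<integral>\<^sup>+z. indicator A z \<partial>marginal_X \<gamma>)"
      by (simp add: marginal_X_def)
    also have "\<dots> = (\<integral>\<^sup>+p. indicator A (fst p) \<partial>\<gamma>)"
      unfolding marginal_X_def by (rule nn_integral_distr) auto
    also have "\<dots> = (\<integral>\<^sup>+p. ennreal (?f p) * indicator A (fst p) \<partial>(P \<Otimes>\<^sub>M \<nu>))"
      unfolding \<gamma>_def by (subst nn_integral_density) auto
    also have "\<dots> = (\<integral>\<^sup>+x. \<integral>\<^sup>+z. ennreal (?f (x, z)) * indicator A x \<partial>\<nu> \<partial>P)"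
      by (subst \<nu>.nn_integral_fst[symmetric]) auto
    also have "\<dots> = (\<integral>\<^sup>+x. ennreal (h x) * indicator A x \<partial>P)"
      by (intro nn_integral_cong) (simp add: nn_integral_multc h(3))
    also have "\<dots> = emeasure (density P h) A" by (simp add: emeasure_density)
    finally show "emeasure (marginal_X \<gamma>) A = emeasure (density P h) A" .
  qed (simp add: marginal_X_def P(2))
  \<comment> \<open>\<open>\<nu>\<close> is given the constant density 1 so that the rule for
    products of densities applies.\<close>
  have "density P h \<Otimes>\<^sub>M \<nu> = density P h \<Otimes>\<^sub>M density \<nu> (\<lambda>_. 1)"
    by (simp add: density_1)
  also have "\<dots> = density (P \<Otimes>\<^sub>M \<nu>) (\<lambda>(x, z). ennreal (h x) * 1)"
    by (intro pair_measure_density) (simp_all add: density_1 \<nu>.sigma_finite_measure_axioms)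
  finally have dens: "density P h \<Otimes>\<^sub>M \<nu> = density (P \<Otimes>\<^sub>M \<nu>) (\<lambda>p. ennreal (h (fst p)))"
    by (simp add: case_prod_beta')
  have "ennreal (h (fst p)) * ennreal (?f p / h (fst p)) = ennreal (?f p)" for p
    using h(2)[of "fst p"] by (subst ennreal_mult'[symmetric]) (auto simp: less_imp_le)
  then show "\<gamma> = density (density P h \<Otimes>\<^sub>M \<nu>) (\<lambda>p. ?f p / h (fst p))"
    unfolding dens \<gamma>_def by (subst density_density_eq) auto
qed

text \<open>For the posterior coupling the density factors as \<open>r p * h (fst p)\<close>, so the
  bracket in \<open>relaxed_cost_eq\<close> vanishes. The work lies in integrability, obtained from
  upper bounds on \<open>h\<close> and \<open>r\<close>.\<close>

lemma relaxed_cost_attained: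
  fixes P :: "'a::euclidean_space measure"
  assumes "n \<ge> 1" and "\<sigma> > 0" and P: "prob_space P" "sets P = sets borel"
  obtains \<gamma> where "\<gamma> \<in> half_couplings (empirical_measure n y)"
    "absolutely_continuous P (marginal_X \<gamma>)"
    "relaxed_cost (\<sigma>\<^sup>2) P \<gamma> = ereal (min_relaxed_cost \<sigma> n y P)"
proof -
  let ?\<nu> = "empirical_measure n y" and ?f = "posterior_density \<sigma> P"
  define h where "h x = (\<Sum>i=1..n. ?f (x, y i)) / real n" for x
  define r where "r p = ?f p / h (fst p)" for p
  define \<gamma> where "\<gamma> = density (P \<Otimes>\<^sub>M ?\<nu>) ?f"
  interpret P: prob_space P by fact
  interpret \<nu>: prob_space ?\<nu> using assms(1) by (rule prob_space_empirical_measure)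
  interpret P\<nu>: pair_prob_space P ?\<nu> ..
  note [measurable_cong] = P(2)
  note [measurable] = borel_measurable_posterior_density[OF P assms(2)]
  have f_pos: "0 < ?f p" for p
    using P assms(2) by (rule posterior_density_pos)
  have h_borel [measurable]: "h \<in> borel_measurable borel"
    unfolding h_def[abs_def] by measurable
  have h_pos: "0 < h x" for x
    unfolding h_def using assms(1) f_pos by (intro divide_pos_pos sum_pos) auto
  have r_borel [measurable]: "r \<in> borel_measurable (borel \<Otimes>\<^sub>M borel)"
    unfolding r_def[abs_def] by measurable
  have r_pos: "0 < r p" for p
    using f_pos h_pos by (simp add: r_def)
  have h_eq: "(\<integral>\<^sup>+z. ennreal (?f (x, z)) \<partial>?\<nu>) = ennreal (h x)" for x
    using assms(1) f_pos
    by (subst nn_integral_eq_integral)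
      (auto simp: integrable_empirical_measure integral_empirical_measure h_def less_imp_le)
  note coupling = density_posterior_half_coupling[OF P assms(2) \<nu>.prob_space_axioms
      sets_empirical_measure h_borel h_pos h_eq, folded \<gamma>_def]
  have \<gamma>: "\<gamma> \<in> half_couplings ?\<nu>" by (rule coupling)
  have r_dens: "\<gamma> = density (density P h \<Otimes>\<^sub>M ?\<nu>) r"
    unfolding r_def[abs_def] by (rule coupling)
  note [measurable_cong] = half_couplingsD(2)[OF \<gamma>]
  interpret \<gamma>: prob_space \<gamma> by (rule half_couplingsD[OF \<gamma>])
  have H: "prob_space (density P h)"
    using half_couplingsD(4)[OF \<gamma>] coupling(2) by simp
  interpret H: prob_space "density P h" by (rule H)
  interpret HY: pair_prob_space "density P h" ?\<nu> ..
  have ac: "absolutely_continuous P (marginal_X \<gamma>)"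
    unfolding coupling(2) by (rule absolutely_continuousI_density) measurable
  \<comment> \<open>The Gaussian density is largest at 0, which bounds each summand of
    \<open>h\<close> uniformly in \<open>x\<close>.\<close>
  define C where "C = (\<Sum>i=1..n. gauss_density \<sigma> (0::'a) / gauss_conv \<sigma> P (y i)) / real n"
  have "h x \<le> C" for x
    unfolding h_def C_def posterior_density_def
    using less_imp_le[OF gauss_conv_pos[OF P assms(2)]]
    by (intro divide_right_mono sum_mono) (auto intro!: divide_right_mono simp: gauss_density_le)
  then have "ln (h x) \<le> ln C" for x
    using h_pos by (metis ln_mono)
  then have "integrable (density P h) (\<lambda>x. ln (h x))"
    using H h_pos by (intro integrable_ln_density[OF P(1)]) (auto simp: less_imp_le)
  then have int_h: "integrable \<gamma> (\<lambda>p. ln (h (fst p)))"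
    unfolding coupling(2)[symmetric] marginal_X_def by (subst (asm) integrable_distr_eq) auto
  \<comment> \<open>The bound on \<open>r\<close> is proved only over observed points, which carry
    the full mass of the second marginal.\<close>
  have "AE z in ?\<nu>. z \<in> y ` {1..n}"
    using assms(1) by (intro AE_empirical_measureI) (auto intro!: borel_closed finite_imp_closed)
  then have "AE z in distr \<gamma> borel snd. z \<in> y ` {1..n}"
    unfolding half_couplingsD(3)[OF \<gamma>, unfolded marginal_Y_def] .
  then have AE_snd: "AE p in \<gamma>. snd p \<in> y ` {1..n}"
    by (subst (asm) AE_distr_iff) (auto intro!: borel_closed finite_imp_closed)
  \<comment> \<open>Every atom of the empirical measure has mass at least \<open>1 / n\<close>.\<close>
  have r_le: "ln (r p) \<le> ln (real n)" if snd_p: "snd p \<in> y ` {1..n}" for p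
  proof -
    from snd_p obtain j where j: "j \<in> {1..n}" "snd p = y j" by auto
    have "?f (fst p, y j) \<le> (\<Sum>i=1..n. ?f (fst p, y i))"
      using j(1) f_pos by (intro member_le_sum) (auto simp: less_imp_le)
    then have "?f p \<le> real n * h (fst p)"
      using assms(1) by (simp add: h_def flip: j(2))
    then have "r p \<le> real n"
      using h_pos[of "fst p"] by (simp add: r_def divide_le_eq)
    then show ?thesis using r_pos[of p] by (metis ln_mono)
  qed
  have r_meas: "r \<in> borel_measurable (density P h \<Otimes>\<^sub>M ?\<nu>)" by measurable
  have "integrable (density (density P h \<Otimes>\<^sub>M ?\<nu>) r) (\<lambda>p. ln (r p))"
  proof (rule integrable_ln_density[OF HY.P.prob_space_axioms _ r_meas])
    show "prob_space (density (density P h \<Otimes>\<^sub>M ?\<nu>) r)"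
      unfolding r_dens[symmetric] by (rule \<gamma>.prob_space_axioms)
    show "AE p in density (density P h \<Otimes>\<^sub>M ?\<nu>) r. ln (r p) \<le> ln (real n)"
      unfolding r_dens[symmetric] using AE_snd r_le by (auto elim!: eventually_mono)
  qed (simp add: r_pos less_imp_le)
  then have int_r: "integrable \<gamma> (\<lambda>p. ln (r p))"
    unfolding r_dens[symmetric] .
  have ln_f: "ln (?f p) = ln (r p) + ln (h (fst p))" for p
    using f_pos[of p] h_pos[of "fst p"] by (simp add: r_def ln_div)
  have int_f: "integrable \<gamma> (\<lambda>p. ln (?f p))"
    unfolding ln_f using int_r int_h by simp
  have "relaxed_cost (\<sigma>\<^sup>2) P \<gamma> = ereal (min_relaxed_cost \<sigma> n y P)"
    unfolding relaxed_cost_eq[OF assms(1,2) P \<gamma> h_borel less_imp_le[OF h_pos] coupling(2) r_borel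
        less_imp_le[OF r_pos] r_dens int_f int_r int_h]
    unfolding ln_f using int_r int_h by simp
  with \<gamma> ac that show ?thesis by blast
qed

section \<open>The value of the relaxed distance and the equivalence\<close>

lemma W_rel_empirical_measure:
  fixes P :: "'a::euclidean_space measure"
  assumes "n \<ge> 1" and "\<sigma> > 0" and P: "prob_space P" "sets P = sets borel"
  shows "W_rel (\<sigma>\<^sup>2) P (empirical_measure n y) = ereal (min_relaxed_cost \<sigma> n y P)"
proof (rule antisym)
  obtain \<gamma> where \<gamma>: "\<gamma> \<in> half_couplings (empirical_measure n y)"
      "absolutely_continuous P (marginal_X \<gamma>)"
      "relaxed_cost (\<sigma>\<^sup>2) P \<gamma> = ereal (min_relaxed_cost \<sigma> n y P)"
    using relaxed_cost_attained[OF assms] .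
  show "W_rel (\<sigma>\<^sup>2) P (empirical_measure n y) \<le> ereal (min_relaxed_cost \<sigma> n y P)"
    unfolding W_rel_def relaxed_cost_def[symmetric] using \<gamma> by (intro INF_lower2[of \<gamma>]) auto
  show "ereal (min_relaxed_cost \<sigma> n y P) \<le> W_rel (\<sigma>\<^sup>2) P (empirical_measure n y)"
    unfolding W_rel_def relaxed_cost_def[symmetric]
    using relaxed_cost_ge[OF assms] by (intro INF_greatest) auto
qed

theorem mainTheorem2:
  fixes n :: nat and \<sigma> :: real and y :: "nat \<Rightarrow> real ^ 'd"
    and \<P> :: "(real ^ 'd) measure set" and P :: "(real ^ 'd) measure"
  assumes "n \<ge> 1" and "\<sigma> > 0" and "\<P> \<subseteq> prob_measures_2"
  shows "is_arg_max (log_likelihood \<sigma> n y) (\<lambda>Q. Q \<in> \<P>) P \<longleftrightarrow>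
    is_arg_min (\<lambda>Q. W_rel (\<sigma>\<^sup>2) Q (empirical_measure n y)) (\<lambda>Q. Q \<in> \<P>) P"
proof -
  have W: "W_rel (\<sigma>\<^sup>2) Q (empirical_measure n y) = ereal (min_relaxed_cost \<sigma> n y Q)"
    if "Q \<in> \<P>" for Q
    using that assms by (intro W_rel_empirical_measure) (auto simp: prob_measures_2_def)
  have "0 < \<sigma>\<^sup>2 / real n" using assms(1,2) by simp
  \<comment> \<open>\<open>is_arg_max\<close> and \<open>is_arg_min\<close> both exclude strictly
    better competitors, so reversing strict inequalities suffices.\<close>
  then have "min_relaxed_cost \<sigma> n y Q < min_relaxed_cost \<sigma> n y R \<longleftrightarrow>
      log_likelihood \<sigma> n y R < log_likelihood \<sigma> n y Q" for Q R
    using mult_less_cancel_left_pos[of "\<sigma>\<^sup>2 / real n"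
        "log_likelihood \<sigma> n y R" "log_likelihood \<sigma> n y Q"]
    unfolding min_relaxed_cost_def by linarith
  with W show ?thesis
    unfolding is_arg_max_def is_arg_min_def by auto
qed

end
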